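(* For every integer $n\ge1$, $$\left\lfloor\left(\sum_{k=n}^\infty\frac{(-1)^k}{B_k}\right)^{-1}\right\rfloor=\begin{cases}B_n+B_{n-1}&\text{if $n$ is even},\\ -(B_n+B_{n-1}+1)&\text{if $n$ is odd}.\end{cases}$$
   Context: The balancing numbers are defined by $B_0=0$, $B_1=1$, $B_n=6B_{n-1}-B_{n-2}$ for $n\ge 2$. $\lfloor x\rfloor$ denotes the floor of a real number $x$. *)

theory Defs
  imports Complex_Main
begin

text \<open>The balancing numbers are integer-valued so that the subtraction in the recurrence is not
  truncated.\<close>

fun balancing :: "nat \<Rightarrow> int" where
  "balancing 0 = 0"
| "balancing (Suc 0) = 1"
| "balancing (Suc (Suc n)) = 6 * balancing (Suc n) - balancing n"

end

theory Submission
  imports Defs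
begin

text \<open>With \<open>s\<^sub>n = B\<^sub>n + B\<^sub>n\<^sub>-\<^sub>1\<close>, Cassini's identity gives \<open>s\<^sub>n + s\<^sub>n\<^sub>+\<^sub>1 = 8 B\<^sub>n\<close> and
  \<open>s\<^sub>n s\<^sub>n\<^sub>+\<^sub>1 = 8 B\<^sub>n\<^sup>2 - 1\<close>, hence \<open>1/B\<^sub>n = 1/s\<^sub>n + 1/s\<^sub>n\<^sub>+\<^sub>1 - e\<^sub>n\<close> with \<open>e\<^sub>n = 1/(B\<^sub>n s\<^sub>n s\<^sub>n\<^sub>+\<^sub>1)\<close>.
  In the alternating sum of the \<open>1/B\<^sub>k\<close> from \<open>k = n\<close> on, the first two terms telescope to \<open>1/s\<^sub>n\<close>.
  The alternating sum of the decreasing \<open>e\<^sub>k\<close> lies strictly above \<open>0\<close> and is at most \<open>e\<^sub>n\<close>, which is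
  smaller than \<open>1/s\<^sub>n - 1/(s\<^sub>n + 1)\<close>.\<close>

lemma balancing_nonneg_less: "0 \<le> balancing n \<and> balancing n < balancing (Suc n)"
  by (induction n) auto

text \<open>A crude linear bound is enough: it keeps denominators positive and makes the reciprocals
  tend to 0.\<close>

lemma balancing_ge: "int n \<le> balancing n"
proof (induction n)
  case (Suc n)
  then show ?case using balancing_nonneg_less[of n] by simp
qed simp

lemma balancing_cassini:
  "balancing n * balancing (Suc (Suc n)) = (balancing (Suc n))\<^sup>2 - 1"
  by (induction n) (auto simp: algebra_simps power2_eq_square)

text \<open>Indices are shifted by one: \<open>balancing_pair n\<close> is \<open>s\<^sub>n\<^sub>+\<^sub>1\<close>, and \<open>balancing_defect n\<close> below is \<open>e\<^sub>n\<^sub>+\<^sub>1\<close>.\<close>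

definition balancing_pair :: "nat \<Rightarrow> int" where
  "balancing_pair n = balancing (Suc n) + balancing n"

lemma balancing_pair_add:
  "balancing_pair n + balancing_pair (Suc n) = 8 * balancing (Suc n)"
  by (simp add: balancing_pair_def)

text \<open>In the expanded product, the recurrence turns the outer neighbours' sum into
  \<open>6 * balancing (Suc n)\<close>; Cassini handles their product, so the squares add up to 6 +
  1 + 1.\<close>

lemma balancing_pair_mult:
  "balancing_pair n * balancing_pair (Suc n) = 8 * (balancing (Suc n))\<^sup>2 - 1"
  using balancing_cassini[of n]
  by (simp add: balancing_pair_def algebra_simps power2_eq_square)

lemma balancing_pair_ge: "int (Suc n) \<le> balancing_pair n"
  using balancing_ge[of "Suc n"] balancing_nonneg_less[of n] by (simp add: balancing_pair_def)

lemma balancing_pair_less: "balancing_pair n + 1 < balancing_pair (Suc n)"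
  using balancing_nonneg_less[of n] balancing_nonneg_less[of "Suc n"]
  by (simp add: balancing_pair_def)

definition balancing_defect :: "nat \<Rightarrow> real" where
  "balancing_defect n = 1 / real_of_int
     (balancing (Suc n) * (balancing_pair n * balancing_pair (Suc n)))"

lemma inverse_balancing_eq:
  "1 / real_of_int (balancing (Suc n)) =
     1 / real_of_int (balancing_pair n) + 1 / real_of_int (balancing_pair (Suc n)) -
     balancing_defect n"
proof -
  define b s t where "b = real_of_int (balancing (Suc n))"
    and "s = real_of_int (balancing_pair n)" and "t = real_of_int (balancing_pair (Suc n))"
  have pos: "b > 0" "s > 0" "t > 0"
    using balancing_ge[of "Suc n"] balancing_pair_ge[of n] balancing_pair_ge[of "Suc n"]
    by (simp_all add: b_def s_def t_def)
  have "s + t = 8 * b"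
    using balancing_pair_add[of n] unfolding b_def s_def t_def by linarith
  moreover have "s * t = 8 * b\<^sup>2 - 1"
    using arg_cong[OF balancing_pair_mult[of n], of real_of_int] by (simp add: b_def s_def t_def)
  \<comment> \<open>Writing \<open>8 * b\<^sup>2\<close> as \<open>b * (8 * b)\<close> eliminates
    the constant 8.\<close>
  ultimately have eq: "s * t = b * (s + t) - 1"
    by (simp add: power2_eq_square)
  have "1 / b = (s * t) / (b * (s * t))"
    using pos by simp
  also have "\<dots> = (b * (s + t) - 1) / (b * (s * t))"
    \<comment> \<open>Only the numerator is rewritten; the denominator keeps
      \<open>s * t\<close>.\<close>
    by (subst (1) eq) (rule refl)
  also have "\<dots> = 1 / s + 1 / t - 1 / (b * (s * t))"
    using pos by (simp add: field_simps)
  finally have "1 / b = 1 / s + 1 / t - 1 / (b * (s * t))" .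
  then show ?thesis
    by (simp add: balancing_defect_def b_def s_def t_def)
qed

lemma balancing_defect_pos: "balancing_defect n > 0"
  using balancing_ge[of "Suc n"] balancing_pair_ge[of n] balancing_pair_ge[of "Suc n"]
  by (simp add: balancing_defect_def)

lemma balancing_defect_Suc_less: "balancing_defect (Suc n) < balancing_defect n"
proof -
  define x where "x k = balancing (Suc k) * (balancing_pair k * balancing_pair (Suc k))" for k
  have "x n < x (Suc n)"
    unfolding x_def
    using balancing_nonneg_less[of "Suc n"] balancing_ge[of "Suc n"]
      balancing_pair_less[of n] balancing_pair_less[of "Suc n"] balancing_pair_ge[of n]
    by (intro mult_strict_mono) auto
  moreover have "0 < x n"
    using balancing_ge[of "Suc n"] balancing_pair_ge[of n] balancing_pair_ge[of "Suc n"]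
    by (simp add: x_def)
  ultimately have "1 / real_of_int (x (Suc n)) < 1 / real_of_int (x n)"
    by (intro divide_strict_left_mono) auto
  then show ?thesis
    unfolding balancing_defect_def x_def .
qed

lemma balancing_defect_less:
  "balancing_defect n <
     1 / real_of_int (balancing_pair n) - 1 / (real_of_int (balancing_pair n) + 1)"
proof -
  define b s t where "b = balancing (Suc n)" and "s = balancing_pair n"
    and "t = balancing_pair (Suc n)"
  have b: "b \<ge> 1" and s: "s \<ge> 1" and t: "t > s + 1"
    using balancing_ge[of "Suc n"] balancing_pair_ge[of n] balancing_pair_less[of n]
    by (simp_all add: b_def s_def t_def)
  \<comment> \<open>The right-hand side of the goal is \<open>1 / (s * (s + 1))\<close>, so after
    cancelling \<open>s\<close> this inequality is all that is needed.\<close>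
  have "s + 1 < b * t"
    using t mult_right_mono[OF b, of t] s by linarith
  then have "s * (s + 1) < b * (s * t)"
    using s mult_strict_left_mono[of "s + 1" "b * t" s] by (simp add: mult.left_commute)
  then have "real_of_int (s * (s + 1)) < real_of_int (b * (s * t))"
    by (rule of_int_less_iff[THEN iffD2])
  then have "1 / real_of_int (b * (s * t)) < 1 / real_of_int (s * (s + 1))"
    using s b t by (intro divide_strict_left_mono) auto
  also have "\<dots> = 1 / real_of_int s - 1 / (real_of_int s + 1)"
    using s by (simp add: field_simps)
  finally show ?thesis
    by (simp add: balancing_defect_def b_def s_def t_def)
qed

lemma inverse_tendsto_0_if_ge:
  fixes f :: "nat \<Rightarrow> int"
  assumes "\<And>n. int (Suc n) \<le> f n"
  shows "(\<lambda>n. 1 / real_of_int (f n)) \<longlonglongrightarrow> 0"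
proof (rule tendsto_sandwich[OF _ _ tendsto_const LIMSEQ_inverse_real_of_nat])
  have "real (Suc n) \<le> real_of_int (f n)" for n
    using assms[of n] by linarith
  then show "\<forall>\<^sub>F n in sequentially. 1 / real_of_int (f n) \<le> inverse (real (Suc n))"
    by (auto simp: divide_inverse intro!: always_eventually le_imp_inverse_le simp del: of_nat_Suc)
  have "0 \<le> f n" for n
    using assms[of n] by simp
  then show "\<forall>\<^sub>F n in sequentially. 0 \<le> 1 / real_of_int (f n)"
    by simp
qed

lemma inverse_balancing_pair_tendsto: "(\<lambda>n. 1 / real_of_int (balancing_pair n)) \<longlonglongrightarrow> 0"
  by (rule inverse_tendsto_0_if_ge[OF balancing_pair_ge])

lemma balancing_defect_tendsto: "balancing_defect \<longlonglongrightarrow> 0"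
proof -
  have "(\<lambda>n. 1 / real_of_int (balancing_pair n) +
      1 / real_of_int (balancing_pair (Suc n)) - 1 / real_of_int (balancing (Suc n)))
      \<longlonglongrightarrow> 0 + 0 - 0"
    by (intro tendsto_intros inverse_balancing_pair_tendsto
        LIMSEQ_Suc[OF inverse_balancing_pair_tendsto] inverse_tendsto_0_if_ge balancing_ge)
  \<comment> \<open>Substituting the decomposition of \<open>1 / balancing (Suc n)\<close> cancels
    everything but the defect.\<close>
  then show ?thesis
    unfolding inverse_balancing_eq by simp
qed

lemma alternating_defect_bounds:
  fixes m :: nat
  defines "d \<equiv> \<lambda>k. (-1) ^ k * balancing_defect (m + k)"
  shows "summable d" "0 < suminf d" "suminf d \<le> balancing_defect m"
proof -
  have lim: "(\<lambda>k. balancing_defect (m + k)) \<longlonglongrightarrow> 0"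
    using LIMSEQ_ignore_initial_segment[OF balancing_defect_tendsto, of m]
    by (simp add: add.commute)
  \<comment> \<open>The unfolding turns \<open>m + Suc k\<close> into \<open>Suc (m + k)\<close>, so
    that the monotonicity premise matches.\<close>
  note leibniz = summable_Leibniz'[OF lim less_imp_le[OF balancing_defect_pos],
      unfolded add_Suc_right, OF less_imp_le[OF balancing_defect_Suc_less]]
  show "summable d"
    unfolding d_def by (rule leibniz)
  show "suminf d \<le> balancing_defect m"
    using leibniz(4)[of 0] by (simp add: d_def)
  \<comment> \<open>The two-term partial sum is a lower bound; it is positive because the defects
    decrease strictly.\<close>
  have "balancing_defect m - balancing_defect (Suc m) \<le> suminf d"
    using leibniz(2)[of 1] by (simp add: d_def numeral_2_eq_2)
  then show "0 < suminf d"
    using balancing_defect_Suc_less[of m] by linarith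
qed

text \<open>The sign is normalised so that the first term is positive, which treats both parities at
  once.\<close>

lemma alternating_inverse_balancing_bounds:
  fixes m :: nat
  defines "T \<equiv> \<Sum>k. (-1) ^ k / real_of_int (balancing (Suc m + k))"
  shows "summable (\<lambda>k. (-1) ^ k / real_of_int (balancing (Suc m + k)))"
    and "1 / (real_of_int (balancing_pair m) + 1) < T"
    and "T < 1 / real_of_int (balancing_pair m)"
proof -
  \<comment> \<open>With the sign built into \<open>f\<close>, the signed sum of two neighbouring
    reciprocals becomes the telescoping difference \<open>f k - f (Suc k)\<close>.\<close>
  define f where "f k = (-1) ^ k * (1 / real_of_int (balancing_pair (m + k)))" for k
  define d where "d = (\<lambda>k. (-1) ^ k * balancing_defect (m + k))"
  have "(\<lambda>k. 1 / real_of_int (balancing_pair (m + k))) \<longlonglongrightarrow> 0"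
    using LIMSEQ_ignore_initial_segment[OF inverse_balancing_pair_tendsto, of m]
    by (simp add: add.commute)
  then have "(\<lambda>k. \<bar>f k\<bar>) \<longlonglongrightarrow> 0"
    unfolding f_def abs_mult by (simp add: tendsto_rabs_zero del: abs_divide)
  then have "f \<longlonglongrightarrow> 0"
    by (rule tendsto_rabs_zero_cancel)
  then have "(\<lambda>k. f k - f (Suc k)) sums f 0"
    using telescope_sums'[of f 0] by simp
  moreover have "d sums suminf d"
    using alternating_defect_bounds(1)[of m] unfolding d_def by (rule summable_sums)
  ultimately have "(\<lambda>k. f k - f (Suc k) - d k) sums (f 0 - suminf d)"
    by (rule sums_diff)
  moreover have "f k - f (Suc k) - d k = (-1) ^ k / real_of_int (balancing (Suc m + k))" for k
    using arg_cong[OF inverse_balancing_eq[of "m + k"], of "(*) ((-1) ^ k)"]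
    by (simp add: f_def d_def algebra_simps)
  ultimately have sums:
    "(\<lambda>k. (-1) ^ k / real_of_int (balancing (Suc m + k))) sums (f 0 - suminf d)"
    by simp
  then show "summable (\<lambda>k. (-1) ^ k / real_of_int (balancing (Suc m + k)))"
    by (rule sums_summable)
  have T: "T = 1 / real_of_int (balancing_pair m) - suminf d"
    using sums_unique[OF sums] by (simp add: T_def f_def)
  show "T < 1 / real_of_int (balancing_pair m)"
    using alternating_defect_bounds(2)[of m] by (simp add: T d_def)
  show "1 / (real_of_int (balancing_pair m) + 1) < T"
    using alternating_defect_bounds(3)[of m] balancing_defect_less[of m] by (simp add: T d_def)
qed

theorem theorem5:
  fixes n :: nat
  assumes "n \<ge> 1"
  shows "\<lfloor>inverse (\<Sum>k. (-1) ^ (n + k) / real_of_int (balancing (n + k)))\<rfloor> =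
    (if even n then balancing n + balancing (n - 1)
     else - (balancing n + balancing (n - 1) + 1))"
proof -
  obtain m where n: "n = Suc m"
    using assms by (cases n) auto
  define T where "T = (\<Sum>k. (-1) ^ k / real_of_int (balancing (Suc m + k)))"
  define s where "s = balancing_pair m"
  have s: "s > 0" "balancing n + balancing (n - 1) = s"
    using balancing_pair_ge[of m] by (simp_all add: s_def n balancing_pair_def)
  have T: "1 / (real_of_int s + 1) < T" "T < 1 / real_of_int s"
    using alternating_inverse_balancing_bounds(2,3)[of m] by (simp_all add: T_def s_def)
  have "T > 0"
    using s by (intro less_trans[OF _ T(1)]) simp
  then have inv: "real_of_int s < inverse T" "inverse T < real_of_int s + 1"
    using T s by (simp_all add: field_simps)
  have "(\<Sum>k. (-1) ^ (n + k) / real_of_int (balancing (n + k))) = (-1) ^ n * T"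
    using suminf_mult[OF alternating_inverse_balancing_bounds(1)[of m], of "(-1) ^ n"]
    by (simp add: T_def n power_add)
  \<comment> \<open>For odd \<open>n\<close> the inverse is negated and lies between
    \<open>- (s + 1)\<close> and \<open>- s\<close>. Its floor is \<open>- (s + 1)\<close> because
    \<open>inverse T\<close> exceeds \<open>s\<close> strictly.\<close>
  then show ?thesis
    using inv unfolding s(2) by (auto simp: floor_eq_iff)
qed

end
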